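(* Let $G$ be a connected graph with $n\geq 2$ vertices, edge set $E(G)$, vertex connectivity $\kappa(G)$ and diameter $\mathrm{diam}(G)$. Then $$a_1(G)\leq\frac{12\,|E(G)|}{\kappa(G)\,\mathrm{diam}(G)\,(\mathrm{diam}(G)-1)\,(\mathrm{diam}(G)-2)+6\,\mathrm{diam}(G)^2}.$$
   Context: Graphs are finite, undirected, with no loops or multiple edges. $a_1(G)=\lambda_2(\mathbf{L}(G))$ is the algebraic connectivity: the second-smallest eigenvalue (counted with multiplicity) of the graph Laplacian $\mathbf{L}(G)$ (diagonal entries $\deg(i)$, off-diagonal entries $-1$ if $\{i,j\}\in E(G)$ and $0$ otherwise). The diameter $\mathrm{diam}(G)$ is the maximum over pairs of vertices of the distance between them (number of edges of a shortest path). For a positive integer $k<n$, a connected graph $G$ with $n$ vertices is $k$-connected if it remains connected after the removal of any subset of fewer than $k$ vertices; the vertex connectivity $\kappa(G)$ is the largest such $k$ for which $G$ is $k$-connected (so $\kappa(K_n)=n-1$). *)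

theory Defs
  imports
    "Graph_Theory.Graph_Theory"
    "Jordan_Normal_Form.Char_Poly"
    "HOL-Library.Multiset"
    "HOL-Computational_Algebra.Polynomial"
begin

text \<open>
  Finite simple undirected graphs are the symmetric, loop-free digraphs without parallel arcs
  of the locale \<^locale>\<open>Digraph.graph\<close>. An undirected edge corresponds to a pair of opposite arcs,
  so edges are counted as unordered pairs and not as arcs. The names \<open>graph\<close> and \<open>connected\<close> are
  qualified because \<open>Map.graph\<close> and \<open>Topological_Spaces.connected\<close> also exist.
\<close>

definition uedges :: "('a, 'b) pre_digraph \<Rightarrow> 'a set set" where
  "uedges G = {{u, v} | u v. u \<rightarrow>\<^bsub>G\<^esub> v}"

definition graph_dist :: "('a, 'b) pre_digraph \<Rightarrow> 'a \<Rightarrow> 'a \<Rightarrow> nat" where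
  "graph_dist G u v = (LEAST k. \<exists>p. pre_digraph.apath G u p v \<and> length p = k)"

definition graph_diameter :: "('a, 'b) pre_digraph \<Rightarrow> nat" where
  "graph_diameter G = Max {graph_dist G u v | u v. u \<in> verts G \<and> v \<in> verts G}"

definition k_connected :: "nat \<Rightarrow> ('a, 'b) pre_digraph \<Rightarrow> bool" where
  "k_connected k G \<longleftrightarrow>
     0 < k \<and> k < card (verts G) \<and> Digraph_Component.connected G \<and>
     (\<forall>S \<subseteq> verts G. card S < k \<longrightarrow> Digraph_Component.connected (G \<restriction> (verts G - S)))"

text \<open>
  For a connected graph with at least two vertices the set below is nonempty (it contains 1)
  and bounded.
\<close>

definition vertex_connectivity :: "('a, 'b) pre_digraph \<Rightarrow> nat" where
  "vertex_connectivity G = Max {k. k_connected k G}"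

text \<open>
  The Laplacian with rows and columns indexed by an enumeration \<open>vs\<close> of the vertices. In a simple
  graph the out-degree of a vertex is its degree.
\<close>

definition laplacian :: "('a, 'b) pre_digraph \<Rightarrow> 'a list \<Rightarrow> real mat" where
  "laplacian G vs = mat (length vs) (length vs)
     (\<lambda>(i, j). if i = j then real (out_degree G (vs ! i))
              else if vs ! i \<rightarrow>\<^bsub>G\<^esub> vs ! j then - 1 else 0)"

text \<open>
  The eigenvalues in increasing order, each repeated according to its multiplicity as a root of the
  characteristic polynomial. For a symmetric real matrix all roots are real, so this list has as
  many entries as the matrix has rows.
\<close>

definition sorted_eigenvalues :: "real mat \<Rightarrow> real list" where
  "sorted_eigenvalues A = sorted_list_of_multiset (proots (char_poly A))"

text \<open>
  The vertex enumeration is arbitrary; lemma \<open>algebraic_connectivity_eq\<close> shows that it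
  does not matter. List indices start at 0, so index 1 is the second-smallest eigenvalue.
\<close>

definition algebraic_connectivity :: "('a, 'b) pre_digraph \<Rightarrow> real" where
  "algebraic_connectivity G =
     sorted_eigenvalues (laplacian G (SOME vs. distinct vs \<and> set vs = verts G)) ! 1"

lemma char_poly_laplacian_reorder:
  assumes "distinct vs" "distinct ws" "set vs = set ws"
  shows "char_poly (laplacian G vs) = char_poly (laplacian G ws)"
proof -
  define n where "n = length vs"
  have len: "length vs = n" "length ws = n"
    using assms by (auto simp: n_def distinct_card[symmetric])
  have "mset vs = mset ws"
    using assms by (simp add: set_eq_iff_mset_eq_distinct)
  then obtain p where p: "p permutes {..<length ws}" "permute_list p ws = vs"
    by (rule mset_eq_permutation)
  have p': "p permutes {0..<n}"
    using p(1) len by (simp add: atLeast0LessThan)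
  have nth: "vs ! i = ws ! (p i)" if "i < n" for i
    using p that len by (metis permute_list_nth)
  have pn: "p i < n" if "i < n" for i
    using permutes_in_image[OF p', of i] that by simp
  have peq: "p i = p j \<longleftrightarrow> i = j" for i j
    using permutes_inj[OF p'] by (auto dest: injD)
  define P :: "real mat" where "P = mat n n (\<lambda>(i, j). if p i = j then 1 else 0)"
  define Q :: "real mat" where "Q = mat n n (\<lambda>(i, j). if i = p j then 1 else 0)"
  define A where "A = laplacian G vs"
  define B where "B = laplacian G ws"
  have car: "A \<in> carrier_mat n n" "B \<in> carrier_mat n n" "P \<in> carrier_mat n n" "Q \<in> carrier_mat n n"
    unfolding A_def B_def P_def Q_def laplacian_def using len by auto
  have mult: "(X * Y) $$ (i, j) = (\<Sum>k = 0..<n. X $$ (i, k) * Y $$ (k, j))"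
    if "X \<in> carrier_mat n n" "Y \<in> carrier_mat n n" "i < n" "j < n" for X Y :: "real mat" and i j
    using that by (auto simp: scalar_prod_def intro!: sum.cong)
  have PQ: "P * Q = 1\<^sub>m n"
  proof (rule eq_matI)
    fix i j assume "i < dim_row (1\<^sub>m n)" "j < dim_col (1\<^sub>m n)"
    then have ij: "i < n" "j < n" by auto
    have "(P * Q) $$ (i, j) = (\<Sum>k = 0..<n. P $$ (i, k) * Q $$ (k, j))"
      using ij car by (intro mult) auto
    also have "\<dots> = (\<Sum>k = 0..<n. (if p i = k then (if p i = p j then 1 else 0) else 0))"
      using ij by (intro sum.cong) (auto simp: P_def Q_def)
    also have "\<dots> = (if p i = p j then 1 else 0)"
      using ij pn by simp
    also have "\<dots> = (1\<^sub>m n) $$ (i, j)"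
      using ij by (simp add: peq)
    finally show "(P * Q) $$ (i, j) = (1\<^sub>m n) $$ (i, j)" .
  qed (auto simp: P_def Q_def)
  have QP: "Q * P = 1\<^sub>m n"
    using mat_mult_left_right_inverse[OF car(3,4) PQ] .
  have PB: "(P * B) $$ (i, j) = B $$ (p i, j)" if ij: "i < n" "j < n" for i j
  proof -
    have "(P * B) $$ (i, j) = (\<Sum>k = 0..<n. P $$ (i, k) * B $$ (k, j))"
      using ij car by (intro mult) auto
    also have "\<dots> = (\<Sum>k = 0..<n. (if p i = k then B $$ (k, j) else 0))"
      using ij by (intro sum.cong) (auto simp: P_def)
    finally show ?thesis using ij pn by simp
  qed
  have "A = P * B * Q"
  proof (rule eq_matI)
    fix i j assume "i < dim_row (P * B * Q)" "j < dim_col (P * B * Q)"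
    then have ij: "i < n" "j < n" using car by auto
    have "(P * B * Q) $$ (i, j) = (\<Sum>k = 0..<n. (P * B) $$ (i, k) * Q $$ (k, j))"
      using ij car by (intro mult) auto
    also have "\<dots> = (\<Sum>k = 0..<n. (if p j = k then B $$ (p i, k) else 0))"
      using ij by (intro sum.cong) (auto simp: PB Q_def simp del: index_mult_mat)
    also have "\<dots> = B $$ (p i, p j)"
      using ij pn by simp
    also have "\<dots> = A $$ (i, j)"
      using ij pn len by (simp add: A_def B_def laplacian_def nth peq)
    finally show "A $$ (i, j) = (P * B * Q) $$ (i, j)" by simp
  qed (use car in auto)
  then have "similar_mat A B"
    using similar_matI[of A B P Q n] car PQ QP by auto
  then show ?thesis
    unfolding A_def B_def by (rule char_poly_similar)
qed

lemma algebraic_connectivity_eq: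
  assumes "distinct vs" "set vs = verts G"
  shows "algebraic_connectivity G = sorted_eigenvalues (laplacian G vs) ! 1"
proof -
  let ?ws = "SOME vs. distinct vs \<and> set vs = verts G"
  have "distinct ?ws \<and> set ?ws = verts G"
    by (rule someI[of "\<lambda>vs. distinct vs \<and> set vs = verts G" vs]) (use assms in auto)
  then have "char_poly (laplacian G ?ws) = char_poly (laplacian G vs)"
    using assms by (intro char_poly_laplacian_reorder) auto
  then show ?thesis
    by (simp add: algebraic_connectivity_def sorted_eigenvalues_def)
qed

end

theory Submission
  imports Defs "Jordan_Normal_Form.Spectral_Radius"
begin

text \<open>
  Let \<open>d\<close> be the diameter, \<open>\<kappa>\<close> the vertex connectivity, and \<open>u\<close>, \<open>v\<close> two vertices at distance \<open>d\<close>.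
  The test function is \<open>f w = dist u w\<close>. It changes by at most one along every edge, so its Laplacian
  quadratic form is at most the number of edges. By the variational principle for the second
  eigenvalue, the algebraic connectivity is at most this number divided by any lower bound for
  the sum of the squares \<open>(f w - c)\<^sup>2\<close> that holds for all \<open>c\<close>
  (lemma \<open>algebraic_connectivity_le_lipschitz\<close>).

  Such a lower bound comes from the distance layers around \<open>u\<close>. Each layer at a distance strictly
  between \<open>0\<close> and \<open>d\<close> separates \<open>u\<close> from \<open>v\<close>, hence has at least \<open>\<kappa>\<close> vertices
  (lemma \<open>card_distance_layer_ge\<close>). The layers \<open>0\<close> and \<open>d\<close> contain \<open>u\<close> and \<open>v\<close>. The sum of squares
  is thus at least \<open>\<kappa>\<close> times the second moment of \<open>1, \<dots>, d - 1\<close> plus that of the two points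
  \<open>0\<close> and \<open>d\<close>. Both moments are smallest about \<open>d / 2\<close>, which gives
  \<open>\<kappa> d (d - 1) (d - 2) / 12 + d\<^sup>2 / 2\<close> (lemma \<open>sum_dist_deviation_ge\<close>), a twelfth of the denominator
  in the theorem.

  The eigenvalues are given as roots of the characteristic polynomial. They are tied to
  the quadratic form by orthogonal diagonalization of real symmetric matrices
  (lemma \<open>symmetric_mat_orthogonally_diagonalizable\<close>), and lemma \<open>second_eigenvalue_le\<close> derives
  from it the part of the variational principle that is used here.
\<close>

section \<open>Orthogonal diagonalization of real symmetric matrices\<close>

lemma symmetric_mat_quadratic_swap:
  fixes A :: "'a :: comm_ring_1 mat"
  assumes A: "A \<in> carrier_mat n n" and sym: "transpose_mat A = A"
    and x: "x \<in> carrier_vec n" and y: "y \<in> carrier_vec n"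
  shows "x \<bullet> (A *\<^sub>v y) = y \<bullet> (A *\<^sub>v x)"
proof -
  have "x \<bullet> (A *\<^sub>v y) = (transpose_mat A *\<^sub>v x) \<bullet> y"
    using transpose_vec_mult_scalar[OF A y x] by simp
  also have "\<dots> = y \<bullet> (A *\<^sub>v x)"
    unfolding sym using A x y by (intro comm_scalar_prod) auto
  finally show ?thesis .
qed

text \<open>
  Over the complex numbers an eigenvector \<open>v\<close> always exists. Evaluating the pairing of \<open>v\<close> with
  \<open>A (conjugate v)\<close> in two ways, by symmetry of \<open>A\<close>, shows that the eigenvalue equals its conjugate.
  It is then a real root of the characteristic polynomial, so it has a real eigenvector as well.
\<close>

lemma symmetric_real_mat_eigenvalue_exists:
  fixes A :: "real mat"
  assumes A: "A \<in> carrier_mat n n" and sym: "transpose_mat A = A" and n: "n > 0"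
  shows "\<exists>e. eigenvalue A e"
proof -
  let ?C = "map_mat complex_of_real A"
  have C: "?C \<in> carrier_mat n n" using A by simp
  obtain z where z: "eigenvalue ?C z"
    using spectrum_non_empty[OF C n] by (auto simp: spectrum_def)
  then obtain v where v: "v \<in> carrier_vec n" "v \<noteq> 0\<^sub>v n" "?C *\<^sub>v v = z \<cdot>\<^sub>v v"
    using A by (auto simp: eigenvalue_def eigenvector_def)
  have cv: "conjugate v \<in> carrier_vec n" using v(1) by auto
  have symC: "transpose_mat ?C = ?C"
    by (metis sym map_mat_transpose)
  have conj: "?C *\<^sub>v conjugate v = cnj z \<cdot>\<^sub>v conjugate v"
  proof -
    have "?C *\<^sub>v conjugate v = conjugate (?C *\<^sub>v v)"
      using A v(1) by (intro eq_vecI) (auto simp: scalar_prod_def sum_conjugate cnj_sum)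
    also have "\<dots> = cnj z \<cdot>\<^sub>v conjugate v"
      unfolding v(3) by (intro eq_vecI) auto
    finally show ?thesis .
  qed
  have "z * (v \<bullet> conjugate v) = conjugate v \<bullet> (?C *\<^sub>v v)"
    unfolding v(3) using v(1) cv by (simp add: comm_scalar_prod[of v n])
  also have "\<dots> = v \<bullet> (?C *\<^sub>v conjugate v)"
    by (rule symmetric_mat_quadratic_swap[OF C symC cv v(1)])
  also have "\<dots> = cnj z * (v \<bullet> conjugate v)"
    unfolding conj using v(1) cv by simp
  finally have "z = cnj z"
    using conjugate_square_eq_0_vec[OF v(1)] v(2) by auto
  then have "z \<in> \<real>" by (simp add: Reals_cnj_iff)
  then obtain r where r: "z = of_real r" by (auto elim: Reals_cases)
  have "poly (char_poly ?C) z = 0"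
    using z eigenvalue_root_char_poly[OF C] by simp
  then have "of_real (poly (char_poly A) r) = (0 :: complex)"
    unfolding r of_real_hom.char_poly_hom[OF A] by simp
  then show ?thesis
    using eigenvalue_root_char_poly[OF A] by auto
qed

text \<open>
  The reflection in the hyperplane orthogonal to \<open>w = u - e\<^sub>0\<close>, where \<open>e\<^sub>0\<close> is the first standard
  basis vector. It exchanges \<open>u\<close> and \<open>e\<^sub>0\<close> because these have the same norm, so it is an
  orthogonal matrix with the prescribed first column, and it is its own inverse.
\<close>

lemma householder_reflection_exists:
  fixes u :: "real vec"
  assumes u: "u \<in> carrier_vec (Suc m)" and unit: "u \<bullet> u = 1"
  obtains W where "W \<in> carrier_mat (Suc m) (Suc m)" "transpose_mat W = W"
    "W * W = 1\<^sub>m (Suc m)" "col W 0 = u"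
proof -
  let ?n = "Suc m"
  define w where "w i = u $ i - (if i = 0 then 1 else 0)" for i
  \<comment> \<open>If \<open>u = e\<^sub>0\<close> then \<open>w = 0\<close> and \<open>s = 0\<close>; division by zero then makes
       \<open>W\<close> the identity matrix, as desired.\<close>
  define s where "s = (\<Sum>k<?n. w k * w k)"
  define W where "W = mat ?n ?n (\<lambda>(i, j). (if i = j then 1 else 0) - 2 * w i * w j / s)"
  have W: "W \<in> carrier_mat ?n ?n" by (simp add: W_def)
  have s_u: "s = 2 - 2 * u $ 0"
  proof -
    have "s = (\<Sum>k<?n. u $ k * u $ k + (if k = 0 then 1 - 2 * u $ 0 else 0))"
      unfolding s_def w_def by (intro sum.cong) (auto simp: algebra_simps)
    also have "\<dots> = u \<bullet> u + (1 - 2 * u $ 0)"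
      using u by (simp add: sum.distrib scalar_prod_def lessThan_atLeast0 del: sum.op_ivl_Suc)
    finally show ?thesis unfolding unit by simp
  qed
  have s0: "w i = 0" if "s = 0" "i < ?n" for i
    using that unfolding s_def by (subst (asm) sum_nonneg_eq_0_iff) auto
  have "transpose_mat W = W"
    by (rule eq_matI) (auto simp: W_def)
  moreover have "W * W = 1\<^sub>m ?n"
  proof (rule eq_matI)
    fix i j assume "i < dim_row (1\<^sub>m ?n)" "j < dim_col (1\<^sub>m ?n)"
    then have ij: "i < ?n" "j < ?n" by auto
    have ss: "(\<Sum>k<?n. (4 * w i * w j / s\<^sup>2) * (w k * w k)) = (4 * w i * w j / s\<^sup>2) * s"
      unfolding s_def sum_distrib_left ..
    have "(W * W) $$ (i, j) = (\<Sum>k<?n. W $$ (i, k) * W $$ (k, j))"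
      using ij W by (simp add: scalar_prod_def lessThan_atLeast0 del: sum.op_ivl_Suc)
    also have "\<dots> = (\<Sum>k<?n. (if i = k then (if k = j then 1 else 0) - 2 * w k * w j / s else 0)
        - (if k = j then 2 * w i * w k / s else 0) + (4 * w i * w j / s\<^sup>2) * (w k * w k))"
      using ij unfolding W_def
      by (intro sum.cong) (auto simp: algebra_simps power2_eq_square)
    also have "\<dots> = ((if i = j then 1 else 0) - 2 * w i * w j / s) - 2 * w i * w j / s
        + (4 * w i * w j / s\<^sup>2) * s"
      using ij unfolding sum.distrib sum_subtractf ss
      by (simp del: sum.lessThan_Suc)
    also have "\<dots> = (if i = j then 1 else 0)"
      by (auto simp: field_simps power2_eq_square)
    finally show "(W * W) $$ (i, j) = 1\<^sub>m ?n $$ (i, j)"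
      using ij by simp
  qed (use W in auto)
  moreover have "col W 0 = u"
  proof (rule eq_vecI)
    fix i assume "i < dim_vec u"
    then have i: "i < ?n" using u by simp
    show "col W 0 $ i = u $ i"
    proof (cases "s = 0")
      case True
      then show ?thesis using i s0[OF True i] by (auto simp: W_def w_def split: if_splits)
    next
      case False
      then have "2 * w i * w 0 / s = - w i"
        unfolding s_u w_def by (simp add: field_simps)
      then show ?thesis using i by (auto simp: W_def w_def split: if_splits)
    qed
  qed (use u W in auto)
  ultimately show ?thesis using W that by blast
qed

text \<open>
  The spectral theorem, by deflation. A reflection \<open>W\<close> moves a unit eigenvector to the first
  coordinate axis. Then \<open>W A W\<close> has the eigenvalue followed by zeros as its first column and, by
  symmetry, as its first row. What remains is a smaller symmetric block.
\<close>

lemma symmetric_mat_orthogonally_diagonalizable: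
  fixes A :: "real mat"
  assumes "A \<in> carrier_mat n n" "transpose_mat A = A"
  shows "\<exists>U D. U \<in> carrier_mat n n \<and> D \<in> carrier_mat n n \<and> diagonal_mat D
    \<and> transpose_mat U * U = 1\<^sub>m n \<and> A * U = U * D"
  using assms
proof (induction n arbitrary: A)
  case 0
  then show ?case
    by (intro exI[of _ "1\<^sub>m 0"]) (auto simp: diagonal_mat_def)
next
  case (Suc m)
  let ?n = "Suc m"
  note A = Suc.prems(1) and sym = Suc.prems(2)
  obtain e v where v: "v \<in> carrier_vec ?n" "v \<noteq> 0\<^sub>v ?n" "A *\<^sub>v v = e \<cdot>\<^sub>v v"
    using symmetric_real_mat_eigenvalue_exists[OF A sym] A
    by (auto simp: eigenvalue_def eigenvector_def)
  have vv: "v \<bullet> v > 0"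
    using conjugate_square_greater_0_vec[OF v(1)] v(2) by simp
  define u where "u = (1 / sqrt (v \<bullet> v)) \<cdot>\<^sub>v v"
  have u: "u \<in> carrier_vec ?n" "u \<bullet> u = 1" "A *\<^sub>v u = e \<cdot>\<^sub>v u"
    using v vv A by (auto simp: u_def mult_mat_vec smult_smult_assoc mult.commute)
  obtain W where W: "W \<in> carrier_mat ?n ?n" "transpose_mat W = W" "W * W = 1\<^sub>m ?n" "col W 0 = u"
    using householder_reflection_exists[OF u(1,2)] .
  define B where "B = W * A * W"
  have B: "B \<in> carrier_mat ?n ?n" using A W by (simp add: B_def)
  have symB: "transpose_mat B = B"
    unfolding B_def using A W sym by (simp add: transpose_mult[of _ ?n ?n _ ?n] assoc_mult_mat[of _ ?n ?n _ ?n _ ?n])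
  have colB: "col B 0 = e \<cdot>\<^sub>v unit_vec ?n 0"
  proof -
    have "col B 0 = W *\<^sub>v (A *\<^sub>v u)"
      unfolding B_def W(4)[symmetric] using A W(1) u(1)[folded W(4)]
      by (subst col_mult2[of _ ?n ?n _ ?n], auto intro!: assoc_mult_mat_vec)
    also have "\<dots> = e \<cdot>\<^sub>v (W *\<^sub>v col W 0)"
      unfolding u(3) W(4) using W u by (simp add: mult_mat_vec)
    also have "W *\<^sub>v col W 0 = col (W * W) 0"
      using W by (intro col_mult2[symmetric]) auto
    also have "\<dots> = unit_vec ?n 0" unfolding W(3) by simp
    finally show ?thesis .
  qed
  have B0: "B $$ (i, 0) = (if i = 0 then e else 0)" if "i < ?n" for i
    using arg_cong[OF colB, of "\<lambda>c. c $ i"] that B by auto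
  have B0': "B $$ (0, i) = (if i = 0 then e else 0)" if "i < ?n" for i
    using B0[OF that] symB that B by (metis carrier_matD index_transpose_mat(1) zero_less_Suc)
  define C where "C = mat m m (\<lambda>(i, j). B $$ (Suc i, Suc j))"
  have C: "C \<in> carrier_mat m m" by (simp add: C_def)
  let ?E = "mat 1 1 (\<lambda>_. e)"
  have Bblock: "B = four_block_mat ?E (0\<^sub>m 1 m) (0\<^sub>m m 1) C"
    using B B0 B0' by (intro eq_matI) (auto simp: C_def)
  have "transpose_mat C = C"
    using arg_cong[OF symB, of "\<lambda>X. X $$ (Suc i, Suc j)" for i j] B
    unfolding C_def by (intro eq_matI) (auto, metis B carrier_matD index_transpose_mat(1) not_less_eq symB)
  from Suc.IH[OF C this] obtain V D where V: "V \<in> carrier_mat m m" "D \<in> carrier_mat m m"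
    "diagonal_mat D" "transpose_mat V * V = 1\<^sub>m m" "C * V = V * D" by blast
  define V' where "V' = four_block_mat (1\<^sub>m 1) (0\<^sub>m 1 m) (0\<^sub>m m 1) V"
  define D' where "D' = four_block_mat ?E (0\<^sub>m 1 m) (0\<^sub>m m 1) D"
  have V': "V' \<in> carrier_mat ?n ?n" "D' \<in> carrier_mat ?n ?n"
    using V by (auto simp: V'_def D'_def)
  have WWX: "W * (W * X) = X" if "X \<in> carrier_mat ?n ?n" for X
    using that W(1,3) by (metis assoc_mult_mat left_mult_one_mat)
  have "transpose_mat V' * V' = 1\<^sub>m ?n"
    unfolding V'_def using V
    by (simp add: transpose_four_block_mat[of _ 1 1 _ m _ m] mult_four_block_mat[of _ 1 1 _ m _ m _ _ 1 _ m])
  moreover have "B * V' = V' * D'"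
    unfolding V'_def D'_def Bblock using V C
    by (simp add: mult_four_block_mat[of _ 1 1 _ m _ m _ _ 1 _ m])
  moreover have "diagonal_mat D'"
    using V unfolding D'_def diagonal_mat_def by auto
  moreover have "transpose_mat (W * V') * (W * V') = transpose_mat V' * V'"
    using W(1,2) V' WWX[OF V'(1)]
    by (simp add: transpose_mult[of _ ?n ?n _ ?n] assoc_mult_mat[of _ ?n ?n _ ?n _ ?n])
  moreover have "A * (W * V') = (W * V') * D'" if "B * V' = V' * D'"
  proof -
    have "A * (W * V') = W * (W * (A * (W * V')))"
      using W V' A by (intro WWX[symmetric]) auto
    also have "\<dots> = W * (B * V')"
      unfolding B_def using W(1) V' A by (simp add: assoc_mult_mat[of _ ?n ?n _ ?n _ ?n])
    also have "\<dots> = (W * V') * D'"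
      unfolding that using W(1) V' by (simp add: assoc_mult_mat[of _ ?n ?n _ ?n _ ?n])
    finally show ?thesis .
  qed
  ultimately show ?case
    using W V' by (intro exI[of _ "W * V'"] exI[of _ D']) auto
qed

section \<open>A variational bound for the second-smallest eigenvalue\<close>

lemma proots_linear_factors:
  "proots (\<Prod>a\<leftarrow>es. [:- a, 1:]) = mset (es :: 'a :: idom list)"
proof (induction es)
  case (Cons a es)
  have "(\<Prod>a\<leftarrow>es. [:- a, 1:]) \<noteq> 0" by (auto simp: prod_list_zero_iff)
  then have "proots (\<Prod>a\<leftarrow>a # es. [:- a, 1:]) = proots [:- a, 1:] + proots (\<Prod>a\<leftarrow>es. [:- a, 1:])"
    by (simp only: list.map prod_list.Cons, intro proots_mult) auto
  then show ?case using Cons.IH by simp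
qed simp

text \<open>
  Translates a statement about the sorted list into one about positions in an unsorted list, such as
  the diagonal of a matrix.
\<close>

lemma at_most_one_le_if_second_smallest_gt:
  fixes es :: "'a :: linorder list"
  assumes len: "2 \<le> length es" and gt: "R < sort es ! 1"
  obtains k where "\<And>i. i < length es \<Longrightarrow> i \<noteq> k \<Longrightarrow> R < es ! i"
proof -
  obtain a b xs where srt: "sort es = a # b # xs"
    using len by (metis One_nat_def Suc_1 Suc_le_length_iff length_sort)
  have "sorted (a # b # xs)" by (metis sorted_sort srt)
  then have "filter (\<lambda>e. e \<le> R) (b # xs) = []"
    using gt srt by (auto simp: filter_empty_conv)
  then have "length (filter (\<lambda>e. e \<le> R) (sort es)) \<le> 1"
    unfolding srt by simp
  then have "length (filter (\<lambda>e. e \<le> R) es) \<le> 1"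
    by (metis mset_filter mset_sort size_mset)
  then have "card {i. i < length es \<and> es ! i \<le> R} \<le> 1"
    by (simp add: length_filter_conv_card)
  then have "\<exists>k. {i. i < length es \<and> es ! i \<le> R} \<subseteq> {k}"
    by (cases "{i. i < length es \<and> es ! i \<le> R} = {}") (auto simp: card_le_Suc0_iff_eq)
  then show ?thesis using that by (metis (mono_tags, lifting) mem_Collect_eq not_le singletonD subsetD)
qed

text \<open>
  One half of the Courant-Fischer principle, with the plane given by two spanning vectors. If the
  second-smallest eigenvalue exceeded \<open>R\<close>, then all vectors of an orthonormal eigenbasis except at
  most one would belong to eigenvalues above \<open>R\<close>. A plane contains a nonzero vector orthogonal to the
  exceptional basis vector, and there the quadratic form is larger than \<open>R\<close> times the squared norm.
\<close>

lemma second_eigenvalue_le: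
  fixes A :: "real mat"
  assumes A: "A \<in> carrier_mat n n" and sym: "transpose_mat A = A" and n: "2 \<le> n"
    and x: "x \<in> carrier_vec n" and y: "y \<in> carrier_vec n"
    and nonzero: "\<And>a b. a \<noteq> 0 \<or> b \<noteq> 0 \<Longrightarrow> a \<cdot>\<^sub>v x + b \<cdot>\<^sub>v y \<noteq> 0\<^sub>v n"
    and rayleigh: "\<And>a b. (a \<cdot>\<^sub>v x + b \<cdot>\<^sub>v y) \<bullet> (A *\<^sub>v (a \<cdot>\<^sub>v x + b \<cdot>\<^sub>v y))
        \<le> R * ((a \<cdot>\<^sub>v x + b \<cdot>\<^sub>v y) \<bullet> (a \<cdot>\<^sub>v x + b \<cdot>\<^sub>v y))"
  shows "sorted_eigenvalues A ! 1 \<le> R"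
proof (rule ccontr)
  assume gt: "\<not> ?thesis"
  obtain U D where U: "U \<in> carrier_mat n n" and D: "D \<in> carrier_mat n n" "diagonal_mat D"
    and UU: "transpose_mat U * U = 1\<^sub>m n" and AU: "A * U = U * D"
    using symmetric_mat_orthogonally_diagonalizable[OF A sym] by blast
  let ?T = "transpose_mat U"
  have T: "?T \<in> carrier_mat n n" using U by simp
  have UU': "U * ?T = 1\<^sub>m n"
    using mat_mult_left_right_inverse[OF T U UU] .
  have A_eq: "A = U * D * ?T"
    using A U T UU' unfolding AU[symmetric] by (simp add: assoc_mult_mat[of _ n n _ n _ n])
  have "similar_mat A D"
    using A D U T UU UU' A_eq by (intro similar_matI[of _ _ U ?T n]) auto
  moreover have "upper_triangular D"
    using D unfolding diagonal_mat_def upper_triangular_def by auto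
  ultimately have "char_poly A = (\<Prod>a\<leftarrow>diag_mat D. [:- a, 1:])"
    using char_poly_similar char_poly_upper_triangular[OF D(1)] by metis
  then have ev: "sorted_eigenvalues A = sort (diag_mat D)"
    unfolding sorted_eigenvalues_def by (simp add: proots_linear_factors)
  have len: "length (diag_mat D) = n" using D by (simp add: diag_mat_def)
  obtain k where k: "\<And>i. i < n \<Longrightarrow> i \<noteq> k \<Longrightarrow> R < D $$ (i, i)"
    using at_most_one_le_if_second_smallest_gt[of "diag_mat D" R] gt n D(1)
    unfolding ev len by (auto simp: diag_mat_def)
  \<comment> \<open>The vector \<open>g\<close> of the plane is chosen so that its coordinate \<open>k\<close> vanishes.
      If that coordinate vanishes on the whole plane, any nonzero vector serves.\<close>
  define c where "c z = (?T *\<^sub>v z) $ k" for z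
  define a where "a = (if c x = 0 \<and> c y = 0 then 1 else c y)"
  define b where "b = (if c x = 0 \<and> c y = 0 then 0 else - c x)"
  define g where "g = a \<cdot>\<^sub>v x + b \<cdot>\<^sub>v y"
  define p where "p = ?T *\<^sub>v g"
  have ab: "a \<noteq> 0 \<or> b \<noteq> 0" unfolding a_def b_def by auto
  have g: "g \<in> carrier_vec n" using x y by (simp add: g_def)
  have p: "p \<in> carrier_vec n" using g T by (auto simp: p_def)
  have pk: "p $ k = 0" if "k < n"
  proof -
    have "p = a \<cdot>\<^sub>v (?T *\<^sub>v x) + b \<cdot>\<^sub>v (?T *\<^sub>v y)"
      unfolding p_def g_def using T x y by (simp add: mult_add_distrib_mat_vec[of _ n n] mult_mat_vec[of _ n n])
    then have "p $ k = a * c x + b * c y"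
      using that T x y U unfolding c_def by simp
    then show ?thesis unfolding a_def b_def by auto
  qed
  have g_eq: "g = U *\<^sub>v p"
    unfolding p_def using U T g UU' by (simp add: assoc_mult_mat_vec[of _ n n _ n, symmetric])
  have form: "g \<bullet> (X *\<^sub>v g) = p \<bullet> (Y *\<^sub>v p)"
    if "X * U = U * Y" "X \<in> carrier_mat n n" "Y \<in> carrier_mat n n" for X Y
  proof -
    have "X *\<^sub>v g = U *\<^sub>v (Y *\<^sub>v p)"
      using that U p unfolding g_eq by (metis assoc_mult_mat_vec)
    then show ?thesis
      using transpose_vec_mult_scalar[OF U, of "Y *\<^sub>v p" g] that p g U
      by (simp add: p_def)
  qed
  have Dp: "(D *\<^sub>v p) $ i = D $$ (i, i) * p $ i" if "i < n" for i
  proof -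
    have "(D *\<^sub>v p) $ i = (\<Sum>j = 0..<n. D $$ (i, j) * p $ j)"
      using that D p by (simp add: scalar_prod_def)
    also have "\<dots> = (\<Sum>j = 0..<n. if j = i then D $$ (i, i) * p $ i else 0)"
      using that D by (intro sum.cong) (auto simp: diagonal_mat_def)
    finally show ?thesis using that by simp
  qed
  have "g \<bullet> (A *\<^sub>v g) = (\<Sum>i = 0..<n. D $$ (i, i) * (p $ i)\<^sup>2)"
    unfolding form[OF AU A D(1)] using p D Dp
    by (auto simp: scalar_prod_def power2_eq_square intro!: sum.cong)
  moreover have "g \<bullet> g = (\<Sum>i = 0..<n. (p $ i)\<^sup>2)"
    using form[of "1\<^sub>m n" "1\<^sub>m n"] U p g
    by (auto simp: scalar_prod_def power2_eq_square intro!: sum.cong)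
  ultimately have "(\<Sum>i = 0..<n. (D $$ (i, i) - R) * (p $ i)\<^sup>2) \<le> 0"
    using rayleigh[of a b] unfolding g_def[symmetric]
    by (simp add: left_diff_distrib sum_subtractf sum_distrib_left)
  moreover have nn: "0 \<le> (D $$ (i, i) - R) * (p $ i)\<^sup>2" if "i < n" for i
    using k[OF that] pk that by (cases "i = k") auto
  ultimately have "\<forall>i\<in>{0..<n}. (D $$ (i, i) - R) * (p $ i)\<^sup>2 = 0"
    by (subst sum_nonneg_eq_0_iff[symmetric]) (auto intro!: antisym sum_nonneg)
  then have "p $ i = 0" if "i < n" for i
    using k[OF that] pk that by (cases "i = k") force+
  then have "p = 0\<^sub>v n" using p by (intro eq_vecI) auto
  then have "g = 0\<^sub>v n" unfolding g_eq using U by (intro eq_vecI) auto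
  then show False using nonzero[OF ab] unfolding g_def by simp
qed

section \<open>The quadratic form of the Laplacian\<close>

lemma (in nomulti_digraph) out_degree_eq_card_adjacent:
  "out_degree G x = card {y. x \<rightarrow>\<^bsub>G\<^esub> y}"
proof -
  have "bij_betw (head G) (out_arcs G x) {y. x \<rightarrow>\<^bsub>G\<^esub> y}"
  proof (rule bij_betw_imageI)
    show "inj_on (head G) (out_arcs G x)"
      by (rule inj_onI) (auto simp: out_arcs_def arc_to_ends_def intro: no_multi_arcs)
    show "head G ` out_arcs G x = {y. x \<rightarrow>\<^bsub>G\<^esub> y}"
      by (auto simp: out_arcs_def arcs_ends_conv image_iff)
  qed
  then show ?thesis unfolding out_degree_def by (rule bij_betw_same_card)
qed

lemma (in wf_digraph) arcs_ends_Sigma: "arcs_ends G = (SIGMA x:verts G. {y. x \<rightarrow>\<^bsub>G\<^esub> y})"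
  by (auto dest: adj_in_verts)

lemma (in fin_digraph) finite_adjacent: "finite {y. x \<rightarrow>\<^bsub>G\<^esub> y}"
  by (rule finite_subset[OF _ finite_verts]) (auto dest: adj_in_verts)

lemma (in graph) card_arcs_ends_eq_twice_uedges:
  "card (arcs_ends G) = 2 * card (uedges G)"
proof -
  let ?e = "\<lambda>(u, v). {u, v}"
  have img: "?e ` arcs_ends G = uedges G"
    by (auto simp: uedges_def)
  have fin: "finite (arcs_ends G)" by (simp add: arcs_ends_conv)
  have "card {p \<in> arcs_ends G. ?e p = e} = 2" if "e \<in> uedges G" for e
  proof -
    obtain u v where uv: "u \<rightarrow>\<^bsub>G\<^esub> v" "e = {u, v}"
      using \<open>e \<in> uedges G\<close> by (auto simp: uedges_def)
    then have "{p \<in> arcs_ends G. ?e p = e} = {(u, v), (v, u)}"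
      using arcs_ends_symmetric[OF sym_arcs] by (auto simp: doubleton_eq_iff)
    moreover have "u \<noteq> v" using uv adj_not_same by blast
    ultimately show ?thesis by simp
  qed
  then have "(\<Sum>e\<in>uedges G. card {p \<in> arcs_ends G. ?e p = e}) = 2 * card (uedges G)"
    by simp
  moreover have "(\<Sum>e\<in>uedges G. card {p \<in> arcs_ends G. ?e p = e}) = card (arcs_ends G)"
    unfolding card_eq_sum img[symmetric] using fin by (intro sum.group) auto
  ultimately show ?thesis by simp
qed

lemma laplacian_carrier: "laplacian G vs \<in> carrier_mat (length vs) (length vs)"
  by (simp add: laplacian_def)

lemma laplacian_symmetric:
  assumes "symmetric G"
  shows "transpose_mat (laplacian G vs) = laplacian G vs"
  using arcs_ends_symmetric[OF assms]
  by (intro eq_matI) (auto simp: laplacian_def)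

text \<open>
  The sum runs over arcs, so it meets every undirected edge twice; this is the reason for the
  factor one half.
\<close>

lemma (in graph) laplacian_quadratic_form:
  assumes vs: "distinct vs" "set vs = verts G"
  shows "vec (length vs) (\<lambda>i. h (vs ! i)) \<bullet> (laplacian G vs *\<^sub>v vec (length vs) (\<lambda>i. h (vs ! i)))
    = (\<Sum>(x, y)\<in>arcs_ends G. (h x - h y)\<^sup>2) / 2" (is "?g \<bullet> (?L *\<^sub>v ?g) = _")
proof -
  let ?n = "length vs" and ?N = "\<lambda>x. {y. x \<rightarrow>\<^bsub>G\<^esub> y}"
  have reindex: "(\<Sum>i = 0..<?n. F (vs ! i)) = (\<Sum>x\<in>verts G. F x)" for F :: "'a \<Rightarrow> real"
    using sum.reindex_bij_betw[OF bij_betw_nth[OF vs(1) refl vs(2)[symmetric]], of F]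
    unfolding lessThan_atLeast0 .
  have row: "(?L *\<^sub>v ?g) $ i = (\<Sum>y\<in>?N (vs ! i). h (vs ! i) - h y)" if i: "i < ?n" for i
  proof -
    let ?x = "vs ! i"
    have x: "?x \<in> verts G" using nth_mem[OF i] unfolding vs(2) .
    let ?F = "\<lambda>y. (if y = ?x then out_degree G ?x * h ?x else 0) - (if ?x \<rightarrow>\<^bsub>G\<^esub> y then h y else 0)"
    have entry: "?L $$ (i, j) * ?g $ j = ?F (vs ! j)" if j: "j < ?n" for j
    proof (cases "i = j")
      case True
      then show ?thesis using i adj_not_same by (auto simp: laplacian_def)
    next
      case False
      then have "vs ! j \<noteq> ?x" using vs(1) i j by (simp add: nth_eq_iff_index_eq)
      then show ?thesis using False i j by (simp add: laplacian_def)
    qed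
    have "(?L *\<^sub>v ?g) $ i = (\<Sum>j = 0..<?n. ?L $$ (i, j) * ?g $ j)"
      using i by (simp add: laplacian_def scalar_prod_def)
    also have "\<dots> = (\<Sum>j = 0..<?n. ?F (vs ! j))"
      by (intro sum.cong refl entry) simp
    also have "\<dots> = (\<Sum>y\<in>verts G. ?F y)"
      by (rule reindex)
    also have "\<dots> = out_degree G ?x * h ?x - (\<Sum>y\<in>verts G. if ?x \<rightarrow>\<^bsub>G\<^esub> y then h y else 0)"
      using x by (simp add: sum_subtractf)
    also have "(\<Sum>y\<in>verts G. if ?x \<rightarrow>\<^bsub>G\<^esub> y then h y else 0) = (\<Sum>y\<in>?N ?x. h y)"
      by (rule sum.mono_neutral_cong_right) (auto dest: adj_in_verts)
    finally show ?thesis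
      by (simp add: sum_subtractf out_degree_eq_card_adjacent)
  qed
  have "?g \<bullet> (?L *\<^sub>v ?g) = (\<Sum>i = 0..<?n. h (vs ! i) * (\<Sum>y\<in>?N (vs ! i). h (vs ! i) - h y))"
    using row laplacian_carrier[of G vs] by (simp add: scalar_prod_def)
  also have "\<dots> = (\<Sum>x\<in>verts G. \<Sum>y\<in>?N x. h x * (h x - h y))"
    by (subst reindex) (simp add: sum_distrib_left)
  also have "\<dots> = (\<Sum>(x, y)\<in>arcs_ends G. h x * (h x - h y))"
    by (subst arcs_ends_Sigma, rule sum.Sigma) (auto simp: finite_adjacent)
  finally have form: "?g \<bullet> (?L *\<^sub>v ?g) = (\<Sum>(x, y)\<in>arcs_ends G. h x * (h x - h y))" .
  \<comment> \<open>Averaging over both orientations of an edge completes the square.\<close>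
  have "(\<Sum>(x, y)\<in>arcs_ends G. h x * (h x - h y)) = (\<Sum>(x, y)\<in>arcs_ends G. h y * (h y - h x))"
    using arcs_ends_symmetric[OF sym_arcs]
    by (intro sum.reindex_bij_witness[of _ prod.swap prod.swap]) auto
  then have "2 * (?g \<bullet> (?L *\<^sub>v ?g))
      = (\<Sum>(x, y)\<in>arcs_ends G. h x * (h x - h y)) + (\<Sum>(x, y)\<in>arcs_ends G. h y * (h y - h x))"
    using form by simp
  also have "\<dots> = (\<Sum>(x, y)\<in>arcs_ends G. (h x - h y)\<^sup>2)"
    unfolding sum.distrib[symmetric]
    by (intro sum.cong) (auto simp: power2_eq_square algebra_simps)
  finally show ?thesis by simp
qed

section \<open>Distances and the diameter\<close>

text \<open>
  The distance is defined by paths without repeated vertices, but walks are what can be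
  concatenated. Cutting out closed subwalks turns a walk into a path of no greater length, so
  distances can be estimated by walks.
\<close>

lemma (in wf_digraph) shorter_apath_exists:
  assumes "awalk u p v"
  shows "\<exists>q. apath u q v \<and> length q \<le> length p"
  using assms
proof (induction rule: awalk_to_apath_induct)
  case (path p)
  then show ?case by (auto simp: apath_def)
next
  case (decomp p q r s)
  then have "p = q @ r @ s" by (elim awalk_cyc_decompE)
  then show ?case using decomp.IH by fastforce
qed

lemma (in wf_digraph) graph_dist_le_length:
  assumes "awalk u p v"
  shows "graph_dist G u v \<le> length p"
proof -
  obtain q where q: "apath u q v" "length q \<le> length p"
    using shorter_apath_exists[OF assms] by blast
  then have "graph_dist G u v \<le> length q"
    unfolding graph_dist_def by (intro Least_le) auto
  then show ?thesis using q by simp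
qed

lemma (in wf_digraph) graph_dist_attained:
  assumes "u \<rightarrow>\<^sup>* v"
  obtains p where "awalk u p v" "length p = graph_dist G u v"
proof -
  have "\<exists>k p. apath u p v \<and> length p = k"
    using assms reachable_apath by blast
  then have "\<exists>p. apath u p v \<and> length p = graph_dist G u v"
    unfolding graph_dist_def by (rule LeastI_ex)
  then show ?thesis using that awalkI_apath by blast
qed

lemma (in wf_digraph) graph_dist_self:
  assumes "u \<in> verts G"
  shows "graph_dist G u u = 0"
proof -
  have "awalk u [] u" using assms by (simp only: awalk_Nil_iff)
  from graph_dist_le_length[OF this] show ?thesis by simp
qed

lemma (in wf_digraph) graph_dist_pos:
  assumes "u \<rightarrow>\<^sup>* v" "u \<noteq> v"
  shows "0 < graph_dist G u v"
proof -
  obtain p where p: "awalk u p v" "length p = graph_dist G u v"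
    using graph_dist_attained[OF assms(1)] .
  have "p \<noteq> []" using p(1) assms(2) by (auto simp: awalk_Nil_iff)
  then show ?thesis using p(2) by (metis length_greater_0_conv)
qed

lemma (in wf_digraph) graph_dist_step:
  assumes "u \<rightarrow>\<^sup>* x" "x \<rightarrow>\<^bsub>G\<^esub> y"
  shows "graph_dist G u y \<le> graph_dist G u x + 1"
proof -
  obtain p where p: "awalk u p x" "length p = graph_dist G u x"
    using graph_dist_attained[OF assms(1)] .
  obtain e where e: "e \<in> arcs G" "tail G e = x" "head G e = y"
    using assms(2) by auto
  have "awalk x [e] y" using e by (auto simp: awalk_simps)
  then have "awalk u (p @ [e]) y" using p(1) awalk_appendI by blast
  from graph_dist_le_length[OF this] show ?thesis by (simp add: p(2))
qed

lemma (in fin_digraph) finite_graph_dists: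
  "finite {graph_dist G u v | u v. u \<in> verts G \<and> v \<in> verts G}"
proof -
  have "{graph_dist G u v | u v. u \<in> verts G \<and> v \<in> verts G}
      = (\<lambda>(u, v). graph_dist G u v) ` (verts G \<times> verts G)" by auto
  then show ?thesis by simp
qed

lemma (in fin_digraph) graph_dist_le_diameter:
  assumes "u \<in> verts G" "v \<in> verts G"
  shows "graph_dist G u v \<le> graph_diameter G"
proof -
  have "graph_dist G u v \<in> {graph_dist G u v | u v. u \<in> verts G \<and> v \<in> verts G}"
    using assms by blast
  then show ?thesis
    unfolding graph_diameter_def by (rule Max_ge[OF finite_graph_dists])
qed

lemma (in fin_digraph) graph_diameter_attained:
  assumes "verts G \<noteq> {}"
  obtains u v where "u \<in> verts G" "v \<in> verts G" "graph_dist G u v = graph_diameter G"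
proof -
  have "graph_diameter G \<in> {graph_dist G u v | u v. u \<in> verts G \<and> v \<in> verts G}"
    unfolding graph_diameter_def using assms by (intro Max_in finite_graph_dists) auto
  then show ?thesis using that by auto
qed

section \<open>Distance layers and vertex connectivity\<close>

text \<open>
  The set of vertices at an intermediate distance \<open>i\<close> from \<open>u\<close> separates \<open>u\<close> from \<open>v\<close>: distances
  change by at most one along an arc, so a walk cannot jump over the layer. A graph
  that stays connected after the removal of fewer than \<open>k\<close> vertices must therefore have at least \<open>k\<close> vertices in the layer.
\<close>

lemma (in graph) card_distance_layer_ge:
  assumes k: "k_connected k G" and u: "u \<in> verts G" and v: "v \<in> verts G"
    and i: "0 < i" "i < graph_dist G u v"
  shows "k \<le> card {w \<in> verts G. graph_dist G u w = i}"
proof (rule ccontr)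
  let ?S = "{w \<in> verts G. graph_dist G u w = i}"
  let ?H = "G \<restriction> (verts G - ?S)"
  assume "\<not> k \<le> card ?S"
  then have conn: "Digraph_Component.connected ?H"
    using k unfolding k_connected_def by auto
  interpret H: wf_digraph ?H by auto
  have ind: "induced_subgraph ?H G" by auto
  have "strongly_connected ?H"
    using conn induced_graph_imp_symmetric[OF sym_arcs ind]
    by (intro H.symmetric_connected_imp_strongly_connected)
  moreover have "u \<in> verts ?H" "v \<in> verts ?H"
    using u v i graph_dist_self[OF u] by auto
  ultimately have "u \<rightarrow>\<^sup>*\<^bsub>?H\<^esub> v" by (auto simp: strongly_connected_def)
  then have "u \<rightarrow>\<^sup>* v \<and> graph_dist G u v < i"
  proof (induction rule: H.reachable_induct)
    case base
    then show ?case using u i graph_dist_self by simp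
  next
    case (step x y)
    have xy: "x \<rightarrow>\<^bsub>G\<^esub> y" using step(2) by (auto simp: arcs_ends_conv)
    have "graph_dist G u y \<noteq> i"
      using H.adj_in_verts(2)[OF step(2)] by auto
    moreover have "graph_dist G u y \<le> graph_dist G u x + 1"
      using graph_dist_step step(3) xy by blast
    ultimately show ?case using step(3) xy reachable_adj_trans by fastforce
  qed
  then show False using i by simp
qed

lemma (in graph) vertex_connectivity_k_connected:
  assumes conn: "Digraph_Component.connected G" and two: "2 \<le> card (verts G)"
  shows "k_connected (vertex_connectivity G) G"
proof -
  have "k_connected 1 G"
    unfolding k_connected_def
  proof (intro conjI allI impI)
    show "Digraph_Component.connected G" by (fact conn)
    show "1 < card (verts G)" using two by simp
    fix S assume S: "S \<subseteq> verts G" "card S < 1"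
    then have "S = {}" using finite_subset[OF S(1)] by simp
    moreover have "spanning G (G \<restriction> verts G)"
      by (auto simp: spanning_def subgraph_def compatible_def wf_digraph)
    ultimately show "Digraph_Component.connected (G \<restriction> (verts G - S))"
      using wf_digraph.connected_spanning_imp_connected[OF wellformed_induce_subgraph _ conn] by simp
  qed simp
  moreover have "finite {k. k_connected k G}"
    by (rule finite_subset[of _ "{..<card (verts G)}"]) (auto simp: k_connected_def)
  ultimately show ?thesis
    unfolding vertex_connectivity_def using Max_in[of "{k. k_connected k G}"] by auto
qed

text \<open>
  The second moment of \<open>1, \<dots>, m\<close> about \<open>c\<close>: the moment about the centre \<open>(m + 1) / 2\<close> plus \<open>m\<close>
  times the squared offset of \<open>c\<close> from the centre. It is scaled by 12 to clear denominators.
\<close>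

lemma sum_interior_squares:
  fixes c :: real
  shows "12 * (\<Sum>i\<in>{1..<Suc m}. (real i - c)\<^sup>2)
    = real m * (real m + 1) * (real m - 1) + 3 * real m * (real m + 1 - 2 * c)\<^sup>2"
proof (induction m)
  case 0
  have "{1..<Suc 0} = {}" by auto
  then show ?case by (simp only: sum.empty of_nat_0 mult_zero_left mult_zero_right add_0)
next
  case (Suc m)
  have step: "x * (x + 1) * (x - 1) + 3 * x * (x + 1 - 2 * c)\<^sup>2 + 12 * (x + 1 - c)\<^sup>2
      = (x + 1) * (x + 1 + 1) * (x + 1 - 1) + 3 * (x + 1) * (x + 1 + 1 - 2 * c)\<^sup>2" for x :: real
    by Groebner_Basis.algebra
  have "12 * (\<Sum>i\<in>{1..<Suc (Suc m)}. (real i - c)\<^sup>2)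
      = 12 * (\<Sum>i\<in>{1..<Suc m}. (real i - c)\<^sup>2) + 12 * (real m + 1 - c)\<^sup>2"
    by (simp add: add.commute)
  also have "\<dots> = (real m + 1) * (real m + 1 + 1) * (real m + 1 - 1)
      + 3 * (real m + 1) * (real m + 1 + 1 - 2 * c)\<^sup>2"
    unfolding Suc.IH by (rule step)
  finally show ?case by (simp only: of_nat_Suc add.commute)
qed

text \<open>
  Group the vertices by their distance from \<open>u\<close>. The layers \<open>1, \<dots>, d - 1\<close> have at least \<open>k\<close> members
  each, the layers \<open>0\<close> and \<open>d\<close> at least one. Both resulting sums are smallest at \<open>c = d / 2\<close>; the
  first one contributes the term with \<open>k\<close>, the two ends contribute \<open>d\<^sup>2 / 2\<close>.
\<close>

lemma (in graph) sum_dist_deviation_ge: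
  assumes k: "k_connected k G" and u: "u \<in> verts G" and v: "v \<in> verts G"
    and d: "graph_dist G u v = d" "0 < d"
  shows "real k * real d * (real d - 1) * (real d - 2) / 12 + (real d)\<^sup>2 / 2
    \<le> (\<Sum>w\<in>verts G. (real (graph_dist G u w) - c)\<^sup>2)"
proof -
  let ?L = "\<lambda>i. {w \<in> verts G. graph_dist G u w = i}"
  let ?q = "\<lambda>i. (real i - c)\<^sup>2"
  obtain m where m: "d = Suc m" using d(2) by (cases d) auto
  have "real k * real d * (real d - 1) * (real d - 2) / 12
      \<le> real k * (\<Sum>i\<in>{1..<d}. ?q i)"
  proof -
    have "real d * (real d - 1) * (real d - 2) / 12 \<le> (\<Sum>i\<in>{1..<d}. ?q i)"
    proof -
      have "real d * (real d - 1) * (real d - 2) = real m * (real m + 1) * (real m - 1)"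
        unfolding m by simp
      also have "\<dots> \<le> 12 * (\<Sum>i\<in>{1..<d}. ?q i)"
        unfolding m sum_interior_squares by simp
      finally show ?thesis by linarith
    qed
    from mult_left_mono[OF this, of "real k"] show ?thesis
      by (simp only: of_nat_0_le_iff times_divide_eq_right mult.assoc)
  qed
  also have "\<dots> \<le> (\<Sum>i\<in>{1..<d}. real (card (?L i)) * ?q i)"
    unfolding sum_distrib_left
    using card_distance_layer_ge[OF k u v] d by (intro sum_mono mult_right_mono) auto
  finally have interior: "real k * real d * (real d - 1) * (real d - 2) / 12
      \<le> (\<Sum>i\<in>{1..<d}. real (card (?L i)) * ?q i)" .
  have ends: "1 \<le> card (?L 0)" "1 \<le> card (?L d)"
    using u v d graph_dist_self[OF u]
    by (auto simp: Suc_le_eq card_gt_0_iff)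
  have "(real d)\<^sup>2 / 2 \<le> ?q 0 + ?q d"
    using zero_le_power2[of "real d - 2 * c"] by (simp add: power2_eq_square algebra_simps)
  also have "\<dots> \<le> real (card (?L 0)) * ?q 0 + real (card (?L d)) * ?q d"
    using ends mult_right_mono[of 1 "real (card (?L 0))" "?q 0"]
      mult_right_mono[of 1 "real (card (?L d))" "?q d"] by simp
  finally have "real k * real d * (real d - 1) * (real d - 2) / 12 + (real d)\<^sup>2 / 2
      \<le> (\<Sum>i\<in>{1..<d}. real (card (?L i)) * ?q i)
        + (real (card (?L 0)) * ?q 0 + real (card (?L d)) * ?q d)"
    using interior by linarith
  also have "\<dots> = (\<Sum>i\<in>{0..d}. real (card (?L i)) * ?q i)"
  proof -
    have "{0..d} = insert 0 (insert d {1..<d})" using d(2) by auto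
    then show ?thesis using d(2) by simp
  qed
  also have "\<dots> = (\<Sum>i\<in>{0..d}. \<Sum>w\<in>?L i. ?q (graph_dist G u w))"
    by (intro sum.cong) auto
  also have "\<dots> = (\<Sum>w\<in>(\<Union>i\<in>{0..d}. ?L i). ?q (graph_dist G u w))"
    by (rule sum.UNION_disjoint[symmetric]) auto
  also have "\<dots> \<le> (\<Sum>w\<in>verts G. ?q (graph_dist G u w))"
    by (rule sum_mono2) auto
  finally show ?thesis .
qed

section \<open>The bound on the algebraic connectivity\<close>

lemma (in graph) laplacian_form_le_of_lipschitz:
  assumes vs: "distinct vs" "set vs = verts G"
    and lip: "\<And>x y. x \<rightarrow>\<^bsub>G\<^esub> y \<Longrightarrow> \<bar>h x - h y\<bar> \<le> L"
  shows "vec (length vs) (\<lambda>i. h (vs ! i)) \<bullet> (laplacian G vs *\<^sub>v vec (length vs) (\<lambda>i. h (vs ! i)))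
    \<le> real (card (uedges G)) * L\<^sup>2"
proof -
  have "(h x - h y)\<^sup>2 \<le> L\<^sup>2" if "x \<rightarrow>\<^bsub>G\<^esub> y" for x y
    using power_mono[OF lip[OF that], of 2] by simp
  then have "(\<Sum>(x, y)\<in>arcs_ends G. (h x - h y)\<^sup>2) \<le> (\<Sum>p\<in>arcs_ends G. L\<^sup>2)"
    by (intro sum_mono) auto
  also have "\<dots> = 2 * (real (card (uedges G)) * L\<^sup>2)"
    by (simp add: card_arcs_ends_eq_twice_uedges)
  finally show ?thesis
    unfolding laplacian_quadratic_form[OF vs] by simp
qed

text \<open>
  The second eigenvalue is tested on the plane spanned by the constant vector and \<open>f\<close>. A vector
  \<open>a + b f\<close> changes by at most \<open>\<bar>b\<bar>\<close> along an edge, which bounds the quadratic form by \<open>b\<^sup>2\<close> times the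
  number of edges. For \<open>b \<noteq> 0\<close> its squared norm is \<open>b\<^sup>2\<close> times the sum of squared deviations of \<open>f\<close>
  from \<open>c = - a / b\<close>. The bound \<open>M\<close> is uniform in \<open>c\<close>, so the squared norm is at least \<open>b\<^sup>2 M\<close> on the
  whole plane.
\<close>

lemma (in graph) algebraic_connectivity_le_lipschitz:
  assumes two: "2 \<le> card (verts G)"
    and lip: "\<And>x y. x \<rightarrow>\<^bsub>G\<^esub> y \<Longrightarrow> \<bar>f x - f y\<bar> \<le> 1"
    and M: "0 < M" "\<And>c. M \<le> (\<Sum>w\<in>verts G. (f w - c)\<^sup>2)"
  shows "algebraic_connectivity G \<le> real (card (uedges G)) / M"
proof -
  obtain vs where vs: "set vs = verts G" "distinct vs"
    using finite_distinct_list[OF finite_verts] by blast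
  define n where "n = length vs"
  have n: "2 \<le> n" using two vs distinct_card[of vs] by (simp add: n_def)
  let ?A = "laplacian G vs" and ?x = "vec n (\<lambda>_. 1 :: real)" and ?y = "vec n (\<lambda>i. f (vs ! i))"
  let ?h = "\<lambda>a b w. a + b * f w"
  have comb: "a \<cdot>\<^sub>v ?x + b \<cdot>\<^sub>v ?y = vec n (\<lambda>i. ?h a b (vs ! i))" for a b
    by (intro eq_vecI) auto
  have norm: "b\<^sup>2 * M \<le> vec n (\<lambda>i. ?h a b (vs ! i)) \<bullet> vec n (\<lambda>i. ?h a b (vs ! i))" for a b
  proof -
    have "vec n (\<lambda>i. ?h a b (vs ! i)) \<bullet> vec n (\<lambda>i. ?h a b (vs ! i))
        = (\<Sum>i = 0..<n. (?h a b (vs ! i))\<^sup>2)"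
      by (simp add: scalar_prod_def power2_eq_square)
    also have "\<dots> = (\<Sum>w\<in>verts G. (?h a b w)\<^sup>2)"
      using sum.reindex_bij_betw[OF bij_betw_nth[OF vs(2) refl vs(1)[symmetric]],
          of "\<lambda>w. (?h a b w)\<^sup>2"]
      unfolding lessThan_atLeast0 n_def .
    also have "b\<^sup>2 * M \<le> \<dots>"
    proof (cases "b = 0")
      case False
      have scaled: "b\<^sup>2 * (f w - (- a / b))\<^sup>2 = (?h a b w)\<^sup>2" for w
      proof -
        have "b * (f w - (- a / b)) = ?h a b w" using False by (simp add: field_simps)
        then show ?thesis by (metis power_mult_distrib)
      qed
      have "b\<^sup>2 * M \<le> b\<^sup>2 * (\<Sum>w\<in>verts G. (f w - (- a / b))\<^sup>2)"
        by (rule mult_left_mono[OF M(2) zero_le_power2])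
      also have "\<dots> = (\<Sum>w\<in>verts G. (?h a b w)\<^sup>2)"
        unfolding sum_distrib_left scaled ..
      finally show ?thesis .
    qed (simp add: sum_nonneg)
    finally show ?thesis .
  qed
  have "sorted_eigenvalues ?A ! 1 \<le> real (card (uedges G)) / M"
  proof (rule second_eigenvalue_le)
    show "?A \<in> carrier_mat n n" using laplacian_carrier n_def by blast
    show "transpose_mat ?A = ?A" by (rule laplacian_symmetric[OF sym_arcs])
    show "2 \<le> n" "?x \<in> carrier_vec n" "?y \<in> carrier_vec n" using n by auto
  next
    fix a b :: real
    assume ab: "a \<noteq> 0 \<or> b \<noteq> 0"
    show "a \<cdot>\<^sub>v ?x + b \<cdot>\<^sub>v ?y \<noteq> 0\<^sub>v n"
    proof
      assume zero: "a \<cdot>\<^sub>v ?x + b \<cdot>\<^sub>v ?y = 0\<^sub>v n"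
      then have "b\<^sup>2 * M \<le> 0" using norm[of b a] unfolding comb by simp
      then have "b = 0" using M(1) by (auto simp: mult_le_0_iff)
      moreover have "a + b * f (vs ! 0) = 0"
        using arg_cong[OF zero[unfolded comb], of "\<lambda>z. z $ 0"] n by simp
      ultimately show False using ab by simp
    qed
  next
    fix a b :: real
    have "vec n (\<lambda>i. ?h a b (vs ! i)) \<bullet> (?A *\<^sub>v vec n (\<lambda>i. ?h a b (vs ! i)))
        \<le> real (card (uedges G)) * \<bar>b\<bar>\<^sup>2"
      unfolding n_def
    proof (rule laplacian_form_le_of_lipschitz[OF vs(2,1)])
      fix x y assume "x \<rightarrow>\<^bsub>G\<^esub> y"
      then have "\<bar>b\<bar> * \<bar>f x - f y\<bar> \<le> \<bar>b\<bar> * 1" using lip by (intro mult_left_mono) auto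
      then show "\<bar>?h a b x - ?h a b y\<bar> \<le> \<bar>b\<bar>"
        by (simp add: abs_mult[symmetric] right_diff_distrib)
    qed
    also have "\<dots> = real (card (uedges G)) / M * (b\<^sup>2 * M)" using M(1) by simp
    also have "\<dots> \<le> real (card (uedges G)) / M
        * (vec n (\<lambda>i. ?h a b (vs ! i)) \<bullet> vec n (\<lambda>i. ?h a b (vs ! i)))"
      using norm M(1) by (intro mult_left_mono) auto
    finally show "(a \<cdot>\<^sub>v ?x + b \<cdot>\<^sub>v ?y) \<bullet> (?A *\<^sub>v (a \<cdot>\<^sub>v ?x + b \<cdot>\<^sub>v ?y))
        \<le> real (card (uedges G)) / M * ((a \<cdot>\<^sub>v ?x + b \<cdot>\<^sub>v ?y) \<bullet> (a \<cdot>\<^sub>v ?x + b \<cdot>\<^sub>v ?y))"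
      unfolding comb .
  qed
  then show ?thesis
    using algebraic_connectivity_eq[OF vs(2,1)] by simp
qed

theorem theorem9:
  fixes G :: "('a, 'b) pre_digraph"
  assumes "Digraph.graph G"
    and "Digraph_Component.connected G"
    and "card (verts G) \<ge> 2"
  shows "algebraic_connectivity G \<le>
    12 * real (card (uedges G)) /
      (real (vertex_connectivity G) * real (graph_diameter G)
          * (real (graph_diameter G) - 1) * (real (graph_diameter G) - 2)
        + 6 * (real (graph_diameter G))\<^sup>2)"
proof -
  interpret graph G by fact
  let ?k = "vertex_connectivity G" and ?d = "graph_diameter G" and ?E = "real (card (uedges G))"
  have k: "k_connected ?k G"
    using vertex_connectivity_k_connected assms(2,3) by blast
  have reach: "x \<rightarrow>\<^sup>*\<^bsub>G\<^esub> y" if "x \<in> verts G" "y \<in> verts G" for x y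
    using symmetric_connected_imp_strongly_connected[OF sym_arcs assms(2)] that
    by (auto simp: strongly_connected_def)
  have "\<not> is_singleton (verts G)" "verts G \<noteq> {}"
    using assms(3) by (auto simp: is_singleton_altdef)
  then obtain x y where xy: "x \<in> verts G" "y \<in> verts G" "x \<noteq> y"
    by (metis is_singletonI')
  have d: "0 < ?d"
    using graph_dist_pos[OF reach[OF xy(1,2)] xy(3)] graph_dist_le_diameter[OF xy(1,2)] by simp
  obtain u v where uv: "u \<in> verts G" "v \<in> verts G" "graph_dist G u v = ?d"
    using graph_diameter_attained[OF \<open>verts G \<noteq> {}\<close>] .
  define f where "f w = real (graph_dist G u w)" for w
  define M where "M = real ?k * real ?d * (real ?d - 1) * (real ?d - 2) / 12 + (real ?d)\<^sup>2 / 2"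
  \<comment> \<open>The diameter is an integer, so no value lies strictly between 1 and 2.\<close>
  have "0 \<le> (real ?d - 1) * (real ?d - 2)"
  proof (cases "?d = 1")
    case False
    then have "2 \<le> ?d" using d by linarith
    then show ?thesis by (intro mult_nonneg_nonneg) auto
  qed simp
  then have "0 \<le> real ?k * real ?d * ((real ?d - 1) * (real ?d - 2))"
    by (rule mult_nonneg_nonneg[rotated]) simp
  then have "0 \<le> real ?k * real ?d * (real ?d - 1) * (real ?d - 2) / 12"
    by (simp only: mult.assoc zero_le_divide_iff) simp
  moreover have "0 < (real ?d)\<^sup>2 / 2" using d by simp
  ultimately have M: "0 < M" unfolding M_def by (rule add_nonneg_pos)
  have "algebraic_connectivity G \<le> ?E / M"
  proof (rule algebraic_connectivity_le_lipschitz[OF assms(3) _ M])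
    show "M \<le> (\<Sum>w\<in>verts G. (f w - c)\<^sup>2)" for c
      unfolding M_def f_def by (rule sum_dist_deviation_ge[OF k uv d])
    fix x y assume xy: "x \<rightarrow>\<^bsub>G\<^esub> y"
    have "graph_dist G u y \<le> graph_dist G u x + 1"
      using graph_dist_step[OF reach xy] uv(1) adj_in_verts[OF xy] by blast
    moreover have "graph_dist G u x \<le> graph_dist G u y + 1"
      using graph_dist_step[OF reach arcs_ends_symmetric[OF sym_arcs xy]] uv(1) adj_in_verts[OF xy]
      by blast
    ultimately show "\<bar>f x - f y\<bar> \<le> 1" unfolding f_def by linarith
  qed
  also have "\<dots> = 12 * ?E / (12 * M)" by simp
  also have "12 * M = real ?k * real ?d * (real ?d - 1) * (real ?d - 2) + 6 * (real ?d)\<^sup>2"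
    unfolding M_def by simp
  finally show ?thesis .
qed

end
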